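(* Let $I$ be a past interval, $E$ a Banach space, $H\subset\mathrm{Map}(I,E)$ a history space, $F\colon\mathbb{R}\times H\supset\mathrm{dom}(F)\to E$ a map, and $(\sigma_0,\psi_0)\in\mathrm{dom}(F)$. Suppose that $H$ is closed under prolongations. If $F$ is locally Lipschitzian about prolongations at $(\sigma_0,\psi_0)$, then $F$ is locally Lipschitzian about $C^1$-prolongations at $(\sigma_0,\psi_0)$.
   Context: Basic notation. $\mathbb{R}_+=[0,\infty)$, $\mathbb{R}_-=(-\infty,0]$. A past interval is an interval $I\subset\mathbb{R}_-$ with $0\in I$. $\mathrm{Map}(I,E)$ is the linear space of all maps $I\to E$. For an interval $J$, $J+I=\{t+\theta:t\in J,\theta\in I\}$. If $\gamma\colon J+I\to E$ and $t\in J$, then $I_t\gamma\in\mathrm{Map}(I,E)$ is $I_t\gamma(\theta)=\gamma(t+\theta)$. A history space is a linear subspace $H\subset\mathrm{Map}(I,E)$ with a topology for which the linear operations are continuous. Prolongations. For $(\sigma,\psi)\in\mathbb{R}\times\mathrm{Map}(I,E)$, a prolongation (resp. $C^1$-prolongation) of $(\sigma,\psi)$ is a map $\gamma\colon J+I\to E$, where $J$ is an interval with left end point $\sigma\in J$ ($J=\{\sigma\}$ allowed, counting as $C^1$), with $I_\sigma\gamma=\psi$ and $\gamma|_J$ continuous (resp. of class $C^1$). A prolongation of $\psi$ is one of $(0,\psi)$. $H$ is closed under prolongations if $I_t\gamma\in H$ for all $t\ge0$, for every $\psi\in H$ and every prolongation $\gamma\colon\mathbb{R}_++I\to E$ of $\psi$.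 For $v\in E$, $\psi^{\wedge v}\colon\mathbb{R}_++I\to E$ is $\psi^{\wedge v}(t)=\psi(t)$ for $t\in I$ and $\psi^{\wedge v}(t)=\psi(0)+tv$ for $t\ge0$. $\|g\|_{C^1[0,T]}=\sup_{[0,T]}\|g\|_E+\sup_{[0,T]}\|g'\|_E$. $\varGamma_{\sigma,\psi}(T,\delta)$ ($T\ge0$, $0\le\delta\le\infty$) is the set of prolongations $\gamma\colon[\sigma,\sigma+T]+I\to E$ of $(\sigma,\psi)$ with $\sup_{s\in[0,T]}\|\gamma(\sigma+s)-\psi(0)\|_E\le\delta$. $\varGamma^1_{\sigma,\psi}(T,\delta,v)$ ($T>0$) is the set of $C^1$-prolongations $\gamma\colon[\sigma,\sigma+T]+I\to E$ of $(\sigma,\psi)$ with $\|\gamma(\sigma+\cdot)-\psi^{\wedge v}(\cdot)\|_{C^1[0,T]}\le\delta$ and $\gamma'(\sigma)=v$ (right derivative); $\varGamma^1_{\sigma,\psi}(0,\delta,v)=\{\psi(\cdot-\sigma)\}$. Put $$\varLambda_{\sigma,\psi}(T,\delta)=\bigcup_{\tau\in[0,T]}\{(\sigma+\tau,I_{\sigma+\tau}\gamma):\gamma\in\varGamma_{\sigma,\psi}(\tau,\delta)\},$$ $$\varLambda^1_{\sigma,\psi}(T,\delta,v)=\bigcup_{\tau\in[0,T]}\{(\sigma+\tau,I_{\sigma+\tau}\gamma):\gamma\in\varGamma^1_{\sigma,\psi}(\tau,\delta,v)\},$$ and $\varLambda^1_{\sigma,\psi}(T,\delta;F):=\varLambda^1_{\sigma,\psi}(T,\delta,F(\sigma,\psi))$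 for $(\sigma,\psi)\in\mathrm{dom}(F)$. Lipschitz conditions. For $L>0$ and $(t,\phi_1),(t,\phi_2)\in\mathrm{dom}(F)$ with $\mathrm{supp}(\phi_1-\phi_2)$ compact, $L$-(Lip) is the inequality $\|F(t,\phi_1)-F(t,\phi_2)\|_E\le L\|\phi_1-\phi_2\|_\infty$. $F$ is locally Lipschitzian about prolongations (resp. about $C^1$-prolongations) at $(\sigma_0,\psi_0)\in\mathrm{dom}(F)$ if there are $T,\delta,L>0$ such that $L$-(Lip) holds for all $(t,\phi_1),(t,\phi_2)$ in $\varLambda_{\sigma_0,\psi_0}(T,\delta)\cap\mathrm{dom}(F)$ (resp. in $\varLambda^1_{\sigma_0,\psi_0}(T,\delta;F)\cap\mathrm{dom}(F)$). *)

theory Defs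
  imports "HOL-Analysis.Analysis" "HOL-Library.Set_Algebras"
begin

(* Map(I,E) is rendered by extensional I, so that a map I -> E corresponds to exactly one
   HOL function.  For sets of reals, J + I is the Minkowski sum of HOL-Library.Set_Algebras. *)

definition past_interval :: "real set \<Rightarrow> bool" where
  "past_interval I \<longleftrightarrow> is_interval I \<and> I \<subseteq> {..0} \<and> 0 \<in> I"

definition history_space :: "real set \<Rightarrow> (real \<Rightarrow> 'e::real_normed_vector) topology \<Rightarrow>
    (real \<Rightarrow> 'e) set \<Rightarrow> bool" where
  "history_space I X H \<longleftrightarrow>
     H \<subseteq> extensional I \<and>
     (\<lambda>\<theta>\<in>I. 0) \<in> H \<and>
     (\<forall>\<phi>\<in>H. \<forall>\<psi>\<in>H. (\<lambda>\<theta>\<in>I. \<phi> \<theta> + \<psi> \<theta>) \<in> H) \<and>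
     (\<forall>c. \<forall>\<phi>\<in>H. (\<lambda>\<theta>\<in>I. c *\<^sub>R \<phi> \<theta>) \<in> H) \<and>
     topspace X = H \<and>
     continuous_map (prod_topology X X) X (\<lambda>(\<phi>, \<psi>). \<lambda>\<theta>\<in>I. \<phi> \<theta> + \<psi> \<theta>) \<and>
     continuous_map (prod_topology euclideanreal X) X (\<lambda>(c, \<phi>). \<lambda>\<theta>\<in>I. c *\<^sub>R \<phi> \<theta>)"

definition segment_at :: "real set \<Rightarrow> real \<Rightarrow> (real \<Rightarrow> 'e) \<Rightarrow> real \<Rightarrow> 'e" where
  "segment_at I t \<gamma> = (\<lambda>\<theta>\<in>I. \<gamma> (t + \<theta>))"

(* One-sided derivatives at end points belonging to J; for J = {s} the condition is vacuously
   true, since at s within {s} is the trivial filter. *)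
definition C1_on :: "real set \<Rightarrow> (real \<Rightarrow> 'e::real_normed_vector) \<Rightarrow> bool" where
  "C1_on J g \<longleftrightarrow>
     (\<exists>g'. (\<forall>t\<in>J. (g has_vector_derivative g' t) (at t within J)) \<and> continuous_on J g')"

definition prolongation :: "real set \<Rightarrow> real set \<Rightarrow> real \<Rightarrow> (real \<Rightarrow> 'e::real_normed_vector) \<Rightarrow>
    (real \<Rightarrow> 'e) \<Rightarrow> bool" where
  "prolongation I J \<sigma> \<psi> \<gamma> \<longleftrightarrow>
     is_interval J \<and> \<sigma> \<in> J \<and> J \<subseteq> {\<sigma>..} \<and>
     \<gamma> \<in> extensional (J + I) \<and> segment_at I \<sigma> \<gamma> = \<psi> \<and> continuous_on J \<gamma>"

definition C1_prolongation :: "real set \<Rightarrow> real set \<Rightarrow> real \<Rightarrow> (real \<Rightarrow> 'e::real_normed_vector) \<Rightarrow>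
    (real \<Rightarrow> 'e) \<Rightarrow> bool" where
  "C1_prolongation I J \<sigma> \<psi> \<gamma> \<longleftrightarrow>
     is_interval J \<and> \<sigma> \<in> J \<and> J \<subseteq> {\<sigma>..} \<and>
     \<gamma> \<in> extensional (J + I) \<and> segment_at I \<sigma> \<gamma> = \<psi> \<and> C1_on J \<gamma>"

definition closed_under_prolongations ::
    "real set \<Rightarrow> (real \<Rightarrow> 'e::real_normed_vector) set \<Rightarrow> bool" where
  "closed_under_prolongations I H \<longleftrightarrow>
     (\<forall>\<psi>\<in>H. \<forall>\<gamma>. prolongation I {0..} 0 \<psi> \<gamma> \<longrightarrow> (\<forall>t\<ge>0. segment_at I t \<gamma> \<in> H))"

definition affine_prolongation ::
    "real set \<Rightarrow> (real \<Rightarrow> 'e::real_normed_vector) \<Rightarrow> 'e \<Rightarrow> real \<Rightarrow> 'e" where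
  "affine_prolongation I \<psi> v =
     (\<lambda>t\<in>{0..} + I. if t \<in> I then \<psi> t else \<psi> 0 + t *\<^sub>R v)"

definition C1_norm :: "real \<Rightarrow> (real \<Rightarrow> 'e::real_normed_vector) \<Rightarrow> ennreal" where
  "C1_norm T g =
     (SUP s\<in>{0..T}. ennreal (norm (g s))) +
     (SUP s\<in>{0..T}. ennreal (norm (vector_derivative g (at s within {0..T}))))"

definition Gamma0 :: "real set \<Rightarrow> real \<Rightarrow> (real \<Rightarrow> 'e::real_normed_vector) \<Rightarrow> real \<Rightarrow> ennreal \<Rightarrow>
    (real \<Rightarrow> 'e) set" where
  "Gamma0 I \<sigma> \<psi> T \<delta> =
     {\<gamma>. prolongation I {\<sigma>..\<sigma> + T} \<sigma> \<psi> \<gamma> \<and>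
         (SUP s\<in>{0..T}. ennreal (norm (\<gamma> (\<sigma> + s) - \<psi> 0))) \<le> \<delta>}"

definition Gamma1 :: "real set \<Rightarrow> real \<Rightarrow> (real \<Rightarrow> 'e::real_normed_vector) \<Rightarrow> real \<Rightarrow> ennreal \<Rightarrow>
    'e \<Rightarrow> (real \<Rightarrow> 'e) set" where
  "Gamma1 I \<sigma> \<psi> T \<delta> v =
     (if T = 0 then {\<lambda>t\<in>{\<sigma>} + I. \<psi> (t - \<sigma>)}
      else {\<gamma>. C1_prolongation I {\<sigma>..\<sigma> + T} \<sigma> \<psi> \<gamma> \<and>
               C1_norm T (\<lambda>s. \<gamma> (\<sigma> + s) - affine_prolongation I \<psi> v s) \<le> \<delta> \<and>
               (\<gamma> has_vector_derivative v) (at_right \<sigma>)})"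

definition Lambda0 :: "real set \<Rightarrow> real \<Rightarrow> (real \<Rightarrow> 'e::real_normed_vector) \<Rightarrow> real \<Rightarrow> ennreal \<Rightarrow>
    (real \<times> (real \<Rightarrow> 'e)) set" where
  "Lambda0 I \<sigma> \<psi> T \<delta> =
     (\<Union>\<tau>\<in>{0..T}. {(\<sigma> + \<tau>, segment_at I (\<sigma> + \<tau>) \<gamma>) |\<gamma>. \<gamma> \<in> Gamma0 I \<sigma> \<psi> \<tau> \<delta>})"

definition Lambda1 :: "real set \<Rightarrow> real \<Rightarrow> (real \<Rightarrow> 'e::real_normed_vector) \<Rightarrow> real \<Rightarrow> ennreal \<Rightarrow>
    'e \<Rightarrow> (real \<times> (real \<Rightarrow> 'e)) set" where
  "Lambda1 I \<sigma> \<psi> T \<delta> v =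
     (\<Union>\<tau>\<in>{0..T}. {(\<sigma> + \<tau>, segment_at I (\<sigma> + \<tau>) \<gamma>) |\<gamma>. \<gamma> \<in> Gamma1 I \<sigma> \<psi> \<tau> \<delta> v})"

definition Lambda1_of :: "real set \<Rightarrow> real \<Rightarrow> (real \<Rightarrow> 'e::real_normed_vector) \<Rightarrow> real \<Rightarrow>
    ennreal \<Rightarrow> (real \<times> (real \<Rightarrow> 'e) \<rightharpoonup> 'e) \<Rightarrow> (real \<times> (real \<Rightarrow> 'e)) set" where
  "Lambda1_of I \<sigma> \<psi> T \<delta> F = Lambda1 I \<sigma> \<psi> T \<delta> (the (F (\<sigma>, \<psi>)))"

(* The support of a map I -> E is the closure relative to I of the set where it is nonzero. *)
definition map_support :: "real set \<Rightarrow> (real \<Rightarrow> 'e::real_normed_vector) \<Rightarrow> real set" where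
  "map_support I \<phi> = I \<inter> closure {\<theta>\<in>I. \<phi> \<theta> \<noteq> 0}"

definition sup_norm :: "real set \<Rightarrow> (real \<Rightarrow> 'e::real_normed_vector) \<Rightarrow> ennreal" where
  "sup_norm I \<phi> = (SUP \<theta>\<in>I. ennreal (norm (\<phi> \<theta>)))"

(* The Lipschitz inequality is required of those pairs in S with a common time and a compactly
   supported difference; sup_norm takes the value \<infinity> on unbounded differences. *)
definition Lip_on :: "real set \<Rightarrow> (real \<times> (real \<Rightarrow> 'e::real_normed_vector) \<rightharpoonup> 'e) \<Rightarrow> real \<Rightarrow>
    (real \<times> (real \<Rightarrow> 'e)) set \<Rightarrow> bool" where
  "Lip_on I F L S \<longleftrightarrow>
     (\<forall>t \<phi>\<^sub>1 \<phi>\<^sub>2. (t, \<phi>\<^sub>1) \<in> S \<and> (t, \<phi>\<^sub>2) \<in> S \<and> compact (map_support I (\<lambda>\<theta>. \<phi>\<^sub>1 \<theta> - \<phi>\<^sub>2 \<theta>)) \<longrightarrow>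
        ennreal (norm (the (F (t, \<phi>\<^sub>1)) - the (F (t, \<phi>\<^sub>2))))
          \<le> ennreal L * sup_norm I (\<lambda>\<theta>. \<phi>\<^sub>1 \<theta> - \<phi>\<^sub>2 \<theta>))"

definition locally_Lipschitz_about_prolongations ::
    "real set \<Rightarrow> (real \<times> (real \<Rightarrow> 'e::real_normed_vector) \<rightharpoonup> 'e) \<Rightarrow> real \<Rightarrow> (real \<Rightarrow> 'e) \<Rightarrow> bool" where
  "locally_Lipschitz_about_prolongations I F \<sigma>\<^sub>0 \<psi>\<^sub>0 \<longleftrightarrow>
     (\<exists>T>0. \<exists>\<delta>>0. \<exists>L>0. Lip_on I F L (Lambda0 I \<sigma>\<^sub>0 \<psi>\<^sub>0 T (ennreal \<delta>) \<inter> dom F))"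

definition locally_Lipschitz_about_C1_prolongations ::
    "real set \<Rightarrow> (real \<times> (real \<Rightarrow> 'e::real_normed_vector) \<rightharpoonup> 'e) \<Rightarrow> real \<Rightarrow> (real \<Rightarrow> 'e) \<Rightarrow> bool" where
  "locally_Lipschitz_about_C1_prolongations I F \<sigma>\<^sub>0 \<psi>\<^sub>0 \<longleftrightarrow>
     (\<exists>T>0. \<exists>\<delta>>0. \<exists>L>0. Lip_on I F L (Lambda1_of I \<sigma>\<^sub>0 \<psi>\<^sub>0 T (ennreal \<delta>) F \<inter> dom F))"

end

theory Submission
  imports Defs
begin

text \<open>A \<open>C\<^sup>1\<close>-prolongation that stays close to the half-line with slope \<open>v = F(\<sigma>\<^sub>0, \<psi>\<^sub>0)\<close> issuing from
  \<open>\<psi>\<^sub>0(0)\<close> is in particular a continuous prolongation, and it stays close to the point \<open>\<psi>\<^sub>0(0)\<close> as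
  long as the half-line itself has not moved far. Over a time \<open>T\<close> the half-line moves by at most
  \<open>T\<parallel>v\<parallel>\<close>, so a \<open>\<delta>\<close>-tube about it lies in the ball of radius \<open>\<delta> + T\<parallel>v\<parallel>\<close> about \<open>\<psi>\<^sub>0(0)\<close>; hence
  \<open>\<Lambda>\<^sup>1(T, \<delta>, v) \<subseteq> \<Lambda>(T, \<delta> + T\<parallel>v\<parallel>)\<close>, which is \<open>Lambda1_subset_Lambda0\<close>. If (Lip) holds on
  \<open>\<Lambda>(T, \<delta>)\<close>, halving \<open>\<delta>\<close> and shrinking \<open>T\<close> until \<open>T\<parallel>v\<parallel> \<le> \<delta>/2\<close> puts the new \<open>\<Lambda>\<^sup>1\<close> inside it, and
  (Lip) is inherited by subsets with the same constant.\<close>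

lemma C1_on_imp_continuous_on:
  assumes "C1_on J g"
  shows "continuous_on J g"
  using assms unfolding C1_on_def continuous_on_eq_continuous_within
  by (blast intro: has_vector_derivative_continuous)

lemma C1_prolongation_imp_prolongation:
  assumes "C1_prolongation I J \<sigma> \<psi> \<gamma>"
  shows "prolongation I J \<sigma> \<psi> \<gamma>"
  using assms by (simp add: C1_prolongation_def prolongation_def C1_on_imp_continuous_on)

lemma norm_le_C1_norm:
  assumes "s \<in> {0..T}"
  shows "ennreal (norm (g s)) \<le> C1_norm T g"
proof -
  have "ennreal (norm (g s)) \<le> (SUP s\<in>{0..T}. ennreal (norm (g s)))"
    using assms by (rule SUP_upper)
  then show ?thesis
    unfolding C1_norm_def by (simp add: add_increasing2)
qed

text \<open>For \<open>t = 0\<close> both branches of the definition apply, and they agree.\<close>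

lemma affine_prolongation_nonneg:
  assumes "past_interval I" "t \<ge> 0"
  shows "affine_prolongation I \<psi> v t = \<psi> 0 + t *\<^sub>R v"
proof -
  have "t + 0 \<in> {0..} + I"
    using assms by (intro set_plus_intro) (auto simp: past_interval_def)
  moreover have "t = 0" if "t \<in> I"
    using that assms by (force simp: past_interval_def)
  ultimately show ?thesis
    by (auto simp: affine_prolongation_def)
qed

text \<open>At \<open>T = 0\<close> the only member of \<open>\<Gamma>\<^sup>1\<close> is the shifted history; it is a prolongation because its
  segment at \<open>\<sigma>\<close> is the restriction of \<open>\<psi>\<close> to \<open>I\<close>, hence the need for an extensional \<open>\<psi>\<close>. For
  \<open>T > 0\<close>, the triangle inequality through the point \<open>\<psi>(0) + sv\<close> of the half-line gives the radius.\<close>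

lemma Gamma1_subset_Gamma0:
  assumes I: "past_interval I" and \<psi>: "\<psi> \<in> extensional I" and T: "T \<ge> 0"
  shows "Gamma1 I \<sigma> \<psi> T \<delta> v \<subseteq> Gamma0 I \<sigma> \<psi> T (\<delta> + ennreal (T * norm v))"
proof
  fix \<gamma> assume \<gamma>: "\<gamma> \<in> Gamma1 I \<sigma> \<psi> T \<delta> v"
  have "0 \<in> I"
    using I by (simp add: past_interval_def)
  have "prolongation I {\<sigma>..\<sigma> + T} \<sigma> \<psi> \<gamma> \<and>
    (\<forall>s\<in>{0..T}. ennreal (norm (\<gamma> (\<sigma> + s) - \<psi> 0)) \<le> \<delta> + ennreal (T * norm v))"
  proof (cases "T = 0")
    case True
    then have \<gamma>_eq: "\<gamma> = (\<lambda>t\<in>{\<sigma>} + I. \<psi> (t - \<sigma>))"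
      using \<gamma> by (simp add: Gamma1_def)
    have shift: "\<gamma> (\<sigma> + \<theta>) = \<psi> \<theta>" if "\<theta> \<in> I" for \<theta>
      using that by (simp add: \<gamma>_eq set_plus_intro)
    have "segment_at I \<sigma> \<gamma> = \<psi>"
      by (intro extensionalityI[OF _ \<psi>]) (auto simp: segment_at_def shift)
    then have "prolongation I {\<sigma>..\<sigma> + T} \<sigma> \<psi> \<gamma>"
      using True by (auto simp: prolongation_def \<gamma>_eq is_interval_1)
    then show ?thesis
      using True shift[OF \<open>0 \<in> I\<close>] by simp
  next
    case False
    then have C1: "C1_prolongation I {\<sigma>..\<sigma> + T} \<sigma> \<psi> \<gamma>"
      and near: "C1_norm T (\<lambda>s. \<gamma> (\<sigma> + s) - affine_prolongation I \<psi> v s) \<le> \<delta>"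
      using \<gamma> by (auto simp: Gamma1_def)
    have "ennreal (norm (\<gamma> (\<sigma> + s) - \<psi> 0)) \<le> \<delta> + ennreal (T * norm v)" if s: "s \<in> {0..T}" for s
    proof -
      let ?d = "\<gamma> (\<sigma> + s) - affine_prolongation I \<psi> v s"
      have "\<gamma> (\<sigma> + s) - \<psi> 0 = ?d + s *\<^sub>R v"
        using s by (simp add: affine_prolongation_nonneg[OF I])
      then have "norm (\<gamma> (\<sigma> + s) - \<psi> 0) \<le> norm ?d + norm (s *\<^sub>R v)"
        by (metis norm_triangle_ineq)
      also have "\<dots> \<le> norm ?d + T * norm v"
        using s by (simp add: mult_right_mono)
      finally have "ennreal (norm (\<gamma> (\<sigma> + s) - \<psi> 0)) \<le> ennreal (norm ?d) + ennreal (T * norm v)"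
        using T by (simp flip: ennreal_plus add: ennreal_leI)
      also have "ennreal (norm ?d) \<le> \<delta>"
        using norm_le_C1_norm[OF s] near by (rule order_trans)
      finally show ?thesis
        by (simp add: add_right_mono)
    qed
    then show ?thesis
      using C1 by (simp add: C1_prolongation_imp_prolongation)
  qed
  then show "\<gamma> \<in> Gamma0 I \<sigma> \<psi> T (\<delta> + ennreal (T * norm v))"
    by (auto simp: Gamma0_def intro: SUP_least)
qed

lemma Gamma0_mono:
  assumes "\<delta> \<le> \<delta>'"
  shows "Gamma0 I \<sigma> \<psi> T \<delta> \<subseteq> Gamma0 I \<sigma> \<psi> T \<delta>'"
  using assms by (auto simp: Gamma0_def intro: order_trans)

lemma Lambda0_mono:
  assumes "T \<le> T'" "\<delta> \<le> \<delta>'"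
  shows "Lambda0 I \<sigma> \<psi> T \<delta> \<subseteq> Lambda0 I \<sigma> \<psi> T' \<delta>'"
  using assms(1) Gamma0_mono[OF assms(2)] unfolding Lambda0_def by fastforce

lemma Lambda1_subset_Lambda0:
  assumes I: "past_interval I" and \<psi>: "\<psi> \<in> extensional I"
  shows "Lambda1 I \<sigma> \<psi> T \<delta> v \<subseteq> Lambda0 I \<sigma> \<psi> T (\<delta> + ennreal (T * norm v))"
proof -
  have "Gamma1 I \<sigma> \<psi> \<tau> \<delta> v \<subseteq> Gamma0 I \<sigma> \<psi> \<tau> (\<delta> + ennreal (T * norm v))" if "\<tau> \<in> {0..T}" for \<tau>
  proof -
    have "ennreal (\<tau> * norm v) \<le> ennreal (T * norm v)"
      using that by (simp add: ennreal_leI mult_right_mono)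
    then have "Gamma0 I \<sigma> \<psi> \<tau> (\<delta> + ennreal (\<tau> * norm v)) \<subseteq> Gamma0 I \<sigma> \<psi> \<tau> (\<delta> + ennreal (T * norm v))"
      by (intro Gamma0_mono add_left_mono)
    with Gamma1_subset_Gamma0[OF I \<psi>] that show ?thesis
      by fastforce
  qed
  then show ?thesis
    unfolding Lambda0_def Lambda1_def by blast
qed

lemma Lip_on_subset:
  assumes "Lip_on I F L S'" "S \<subseteq> S'"
  shows "Lip_on I F L S"
  using assms unfolding Lip_on_def by blast

theorem proposition4p2:
  fixes I :: "real set"
    and X :: "(real \<Rightarrow> 'e::banach) topology"
    and H :: "(real \<Rightarrow> 'e) set"
    and F :: "real \<times> (real \<Rightarrow> 'e) \<rightharpoonup> 'e"
    and \<sigma>\<^sub>0 :: real and \<psi>\<^sub>0 :: "real \<Rightarrow> 'e"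
  assumes "past_interval I"
    and "history_space I X H"
    and "dom F \<subseteq> UNIV \<times> H"
    and "(\<sigma>\<^sub>0, \<psi>\<^sub>0) \<in> dom F"
    and "closed_under_prolongations I H"
    and "locally_Lipschitz_about_prolongations I F \<sigma>\<^sub>0 \<psi>\<^sub>0"
  shows "locally_Lipschitz_about_C1_prolongations I F \<sigma>\<^sub>0 \<psi>\<^sub>0"
proof -
  obtain T \<delta> L where pos: "T > 0" "\<delta> > 0" "L > 0"
    and Lip: "Lip_on I F L (Lambda0 I \<sigma>\<^sub>0 \<psi>\<^sub>0 T (ennreal \<delta>) \<inter> dom F)"
    using assms(6) unfolding locally_Lipschitz_about_prolongations_def by blast
  have \<psi>: "\<psi>\<^sub>0 \<in> extensional I"
    using assms(2-4) by (auto simp: history_space_def)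
  define v where "v = the (F (\<sigma>\<^sub>0, \<psi>\<^sub>0))"
  \<comment> \<open>The summand 1 keeps the denominator positive when \<open>v = 0\<close>.\<close>
  define T' where "T' = min T (\<delta> / (2 * (norm v + 1)))"
  have T': "T' > 0" "T' \<le> T"
    using pos by (simp_all add: T'_def add_nonneg_pos)
  have "T' * norm v \<le> T' * (norm v + 1)"
    using T' by simp
  also have "\<dots> \<le> \<delta> / (2 * (norm v + 1)) * (norm v + 1)"
    by (intro mult_right_mono) (simp_all add: T'_def)
  also have "\<dots> = \<delta> / 2"
    using add_nonneg_pos[OF norm_ge_zero[of v] zero_less_one] by (simp add: field_simps)
  finally have "ennreal (\<delta> / 2) + ennreal (T' * norm v) \<le> ennreal \<delta>"
    using pos T' by (simp flip: ennreal_plus add: ennreal_leI)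
  with T' have "Lambda1 I \<sigma>\<^sub>0 \<psi>\<^sub>0 T' (ennreal (\<delta> / 2)) v \<subseteq> Lambda0 I \<sigma>\<^sub>0 \<psi>\<^sub>0 T (ennreal \<delta>)"
    by (intro order_trans[OF Lambda1_subset_Lambda0[OF assms(1) \<psi>] Lambda0_mono])
  then have "Lip_on I F L (Lambda1_of I \<sigma>\<^sub>0 \<psi>\<^sub>0 T' (ennreal (\<delta> / 2)) F \<inter> dom F)"
    unfolding Lambda1_of_def v_def by (intro Lip_on_subset[OF Lip]) blast
  moreover have "\<delta> / 2 > 0"
    using pos by simp
  ultimately show ?thesis
    unfolding locally_Lipschitz_about_C1_prolongations_def using T'(1) pos(3) by blast
qed

end
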